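(* Let $(L,\mu,\varepsilon,\alpha_L)$ be a color Hom-Leibniz algebra. Write $x\cdot y=\mu(x,y)$ and, for homogeneous $x,y$, $[x,y]=x\cdot y-\varepsilon(x,y)\,y\cdot x$. Then for all homogeneous $x,y,z\in L$, $$\big(x\cdot y+\varepsilon(x,y)\,y\cdot x\big)\cdot\alpha_L(z)=0,$$ $$[x\cdot y,\alpha_L(z)]+\varepsilon(x,y)[\alpha_L(y),x\cdot z]=\alpha_L(x)\cdot[y,z].$$
   Context: $\mathbf K$ is a field of characteristic $0$ and $G$ is an abelian group (written additively). A linear (or bilinear) map between $G$-graded vector spaces is even if it preserves degrees. A bicharacter is a map $\varepsilon:G\times G\to\mathbf K^*$ with $\varepsilon(a,b)\varepsilon(b,a)=1$, $\varepsilon(a,b+c)=\varepsilon(a,b)\varepsilon(a,c)$, $\varepsilon(a+b,c)=\varepsilon(a,c)\varepsilon(b,c)$. For homogeneous $x,y$ of degrees $a,b$ one writes $\varepsilon(x,y):=\varepsilon(a,b)$. A (left) color Hom-Leibniz algebra is a quadruple $(L,\mu,\varepsilon,\alpha_L)$ consisting of a $G$-graded vector space $L$, an even bilinear map $\mu:L\otimes L\to L$, a bicharacter $\varepsilon$ and an even linear map $\alpha_L:L\to L$ such that for all homogeneous $x,y,z\in L$ $$\mu(\alpha_L(x),\mu(y,z))=\mu(\mu(x,y),\alpha_L(z))+\varepsilon(x,y)\mu(\alpha_L(y),\mu(x,z)).$$ *)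

theory Defs
  imports Complex_Main
begin

text \<open>The group \<open>G\<close> is the additive type \<open>'g\<close>; \<open>V a\<close> is the homogeneous component of degree \<open>a\<close>.\<close>

locale graded_vector_space = vector_space scale
  for scale :: "'k::field_char_0 \<Rightarrow> 'v::ab_group_add \<Rightarrow> 'v" +
  fixes V :: "'g::ab_group_add \<Rightarrow> 'v set"
  assumes subspace_component: "subspace (V a)"
    and direct_sum: "\<exists>!f. (\<forall>a. f a \<in> V a) \<and> finite {a. f a \<noteq> 0} \<and> v = (\<Sum>a | f a \<noteq> 0. f a)"

definition bicharacter :: "('g::ab_group_add \<Rightarrow> 'g \<Rightarrow> 'k::field_char_0) \<Rightarrow> bool" where
  "bicharacter \<epsilon> \<longleftrightarrow>
     (\<forall>a b. \<epsilon> a b \<noteq> 0) \<and>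
     (\<forall>a b. \<epsilon> a b * \<epsilon> b a = 1) \<and>
     (\<forall>a b c. \<epsilon> a (b + c) = \<epsilon> a b * \<epsilon> a c) \<and>
     (\<forall>a b c. \<epsilon> (a + b) c = \<epsilon> a c * \<epsilon> b c)"

text \<open>For \<open>x \<in> V a\<close> and \<open>y \<in> V b\<close>, the scalar written \<open>\<epsilon>(x,y)\<close> on elements is \<open>\<epsilon> a b\<close>;
  the degrees are kept explicit because the zero vector is homogeneous of every degree.\<close>

locale color_hom_Leibniz_algebra = graded_vector_space scale V
  for scale :: "'k::field_char_0 \<Rightarrow> 'v::ab_group_add \<Rightarrow> 'v"
    and V :: "'g::ab_group_add \<Rightarrow> 'v set" +
  fixes \<mu> :: "'v \<Rightarrow> 'v \<Rightarrow> 'v"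
    and \<epsilon> :: "'g \<Rightarrow> 'g \<Rightarrow> 'k"
    and \<alpha> :: "'v \<Rightarrow> 'v"
  assumes linear_mult_right: "Vector_Spaces.linear scale scale (\<lambda>y. \<mu> x y)"
    and linear_mult_left: "Vector_Spaces.linear scale scale (\<lambda>x. \<mu> x y)"
    and even_mult: "x \<in> V a \<Longrightarrow> y \<in> V b \<Longrightarrow> \<mu> x y \<in> V (a + b)"
    and bicharacter: "bicharacter \<epsilon>"
    and linear_twist: "Vector_Spaces.linear scale scale \<alpha>"
    and even_twist: "x \<in> V a \<Longrightarrow> \<alpha> x \<in> V a"
    and color_hom_Leibniz: "x \<in> V a \<Longrightarrow> y \<in> V b \<Longrightarrow> z \<in> V c \<Longrightarrow>
      \<mu> (\<alpha> x) (\<mu> y z) = \<mu> (\<mu> x y) (\<alpha> z) + scale (\<epsilon> a b) (\<mu> (\<alpha> y) (\<mu> x z))"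

text \<open>The bracket \<open>[x,y]\<close> of \<open>x\<close> of degree \<open>a\<close> and \<open>y\<close> of degree \<open>b\<close>. On homogeneous elements its
  value does not depend on the degrees assigned to zero, since then both summands vanish.\<close>

definition color_bracket ::
  "('k::field_char_0 \<Rightarrow> 'v::ab_group_add \<Rightarrow> 'v) \<Rightarrow> ('v \<Rightarrow> 'v \<Rightarrow> 'v) \<Rightarrow>
   ('g::ab_group_add \<Rightarrow> 'g \<Rightarrow> 'k) \<Rightarrow> 'g \<Rightarrow> 'g \<Rightarrow> 'v \<Rightarrow> 'v \<Rightarrow> 'v" where
  "color_bracket scale \<mu> \<epsilon> a b x y = \<mu> x y - scale (\<epsilon> a b) (\<mu> y x)"

end

theory Submission
  imports Defs
begin

text \<open>Both identities are linear combinations of instances of the color Hom-Leibniz rule. The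
  rule for (x,y,z) and \<epsilon>(x,y) times the rule for (y,x,z) contain the same two terms of the
  form \<alpha>(u)(vw), since \<epsilon>(x,y)\<epsilon>(y,x) = 1; eliminating them leaves the first
  identity. The second is the rule for (x,y,z) minus \<epsilon>(y,z) times the rule for (x,z,y),
  once the bicharacter laws have matched the scalars.\<close>

theorem proposition4p1:
  fixes scale :: "'k::field_char_0 \<Rightarrow> 'v::ab_group_add \<Rightarrow> 'v"
    and L :: "'g::ab_group_add \<Rightarrow> 'v set"
    and \<mu> :: "'v \<Rightarrow> 'v \<Rightarrow> 'v"
    and \<epsilon> :: "'g \<Rightarrow> 'g \<Rightarrow> 'k"
    and \<alpha> :: "'v \<Rightarrow> 'v"
    and a b c :: 'g
    and x y z :: 'v
  assumes "color_hom_Leibniz_algebra scale L \<mu> \<epsilon> \<alpha>"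
    and "x \<in> L a" and "y \<in> L b" and "z \<in> L c"
  shows "\<mu> (\<mu> x y + scale (\<epsilon> a b) (\<mu> y x)) (\<alpha> z) = 0 \<and>
    color_bracket scale \<mu> \<epsilon> (a + b) c (\<mu> x y) (\<alpha> z)
      + scale (\<epsilon> a b) (color_bracket scale \<mu> \<epsilon> b (a + c) (\<alpha> y) (\<mu> x z))
      = \<mu> (\<alpha> x) (color_bracket scale \<mu> \<epsilon> b c y z)"
proof -
  interpret color_hom_Leibniz_algebra scale L \<mu> \<epsilon> \<alpha> by fact
  interpret left: Vector_Spaces.linear scale scale "\<lambda>u. \<mu> u v" for v
    by (rule linear_mult_left)
  interpret right: Vector_Spaces.linear scale scale "\<lambda>v. \<mu> u v" for u
    by (rule linear_mult_right)
  have inv: "\<epsilon> a b * \<epsilon> b a = 1"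
    and add_right: "\<epsilon> b (a + c) = \<epsilon> b a * \<epsilon> b c"
    and add_left: "\<epsilon> (a + b) c = \<epsilon> a c * \<epsilon> b c"
    using bicharacter unfolding bicharacter_def by auto
  note leibniz_xyz = color_hom_Leibniz[OF assms(2,3,4)]
    and leibniz_yxz = color_hom_Leibniz[OF assms(3,2,4)]
    and leibniz_xzy = color_hom_Leibniz[OF assms(2,4,3)]
  \<comment> \<open>The scaling by \<open>\<epsilon> a b\<close> turns the coefficient
    \<open>\<epsilon> b a\<close> of \<alpha>(x)(yz) into 1, so that this term cancels against the
    left side of \<open>leibniz_xyz\<close>.\<close>
  have "scale (\<epsilon> a b) (\<mu> (\<alpha> y) (\<mu> x z))
      = scale (\<epsilon> a b) (\<mu> (\<mu> y x) (\<alpha> z)) + \<mu> (\<alpha> x) (\<mu> y z)"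
    by (simp add: leibniz_yxz scale_right_distrib inv)
  then have "\<mu> (\<mu> x y) (\<alpha> z) + scale (\<epsilon> a b) (\<mu> (\<mu> y x) (\<alpha> z)) = 0"
    using leibniz_xyz by (simp add: algebra_simps)
  then have "\<mu> (\<mu> x y + scale (\<epsilon> a b) (\<mu> y x)) (\<alpha> z) = 0"
    by (simp add: left.add left.scale)
  moreover have "color_bracket scale \<mu> \<epsilon> (a + b) c (\<mu> x y) (\<alpha> z)
      + scale (\<epsilon> a b) (color_bracket scale \<mu> \<epsilon> b (a + c) (\<alpha> y) (\<mu> x z))
      = \<mu> (\<alpha> x) (color_bracket scale \<mu> \<epsilon> b c y z)"
  proof -
    \<comment> \<open>This matches the coefficients of (xz)\<alpha>(y) on the two sides; those of
      \<alpha>(z)(xy) match by \<open>add_left\<close>.\<close>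
    have "\<epsilon> a b * \<epsilon> b (a + c) = \<epsilon> b c"
      using inv by (simp add: add_right flip: mult.assoc)
    then show ?thesis
      unfolding color_bracket_def
      by (simp add: right.diff right.scale
          leibniz_xyz leibniz_xzy scale_right_diff_distrib scale_right_distrib add_left
          mult.commute)
  qed
  ultimately show ?thesis ..
qed

end
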